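(* For every finite graph $G$ and every family of graphs $\mathcal{F}$, $|\iota_{\rm g}(G,\mathcal{F})-\iota_{\rm g}'(G,\mathcal{F})|\le 1$.
   Context: All graphs are finite and simple; $N[S]$ denotes the closed neighborhood of a vertex set $S$. A graph is $\mathcal{F}$-forbidden if it contains no member of $\mathcal{F}$ as a subgraph. In the $\mathcal{F}$-isolation game on $G$, Dominator and Staller alternately choose vertices of $G$; if $S$ is the set of already chosen vertices, a vertex $x$ may be chosen only if it dominates (equals or is adjacent to) some vertex $y$ lying in a component of $G-N[S]$ that is not $\mathcal{F}$-forbidden. The game ends when no such vertex exists. Dominator wants to minimize the number of chosen vertices, Staller wants to maximize it. $\iota_{\rm g}(G,\mathcal{F})$ is the number of chosen vertices under optimal play when Dominator moves first, and $\iota_{\rm g}'(G,\mathcal{F})$ the number when Staller moves first. *)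

theory Defs
  imports "Graph_Theory.Graph_Theory"
begin

text \<open>
  Finite simple graphs are rendered by the locale predicate \<^const>\<open>graph\<close>: finite, loop-free,
  symmetric digraphs without parallel arcs, so that every undirected edge is a pair of
  opposite arcs.
\<close>

definition closed_nbhd :: "('a, 'b) pre_digraph \<Rightarrow> 'a set \<Rightarrow> 'a set" where
  "closed_nbhd G S = {v \<in> verts G. \<exists>u\<in>S. v = u \<or> u \<rightarrow>\<^bsub>G\<^esub> v}"

text \<open>
  The members of a family live on a vertex type of their own; a graph contains \<open>H\<close> as a subgraph
  if some subgraph of it is isomorphic to \<open>H\<close>.
\<close>

definition contains_subgraph :: "('a, 'b) pre_digraph \<Rightarrow> ('c, 'd) pre_digraph \<Rightarrow> bool" where
  "contains_subgraph G H \<longleftrightarrow> (\<exists>K. subgraph K G \<and> digraph_iso H K)"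

definition forbidden :: "('c, 'd) pre_digraph set \<Rightarrow> ('a, 'b) pre_digraph \<Rightarrow> bool" where
  "forbidden F G \<longleftrightarrow> \<not> (\<exists>H\<in>F. contains_subgraph G H)"

definition components :: "('a, 'b) pre_digraph \<Rightarrow> ('a, 'b) pre_digraph set" where
  "components G = {C. pre_digraph.max_subgraph G connected C}"

definition legal_moves ::
  "('a, 'b) pre_digraph \<Rightarrow> ('c, 'd) pre_digraph set \<Rightarrow> 'a set \<Rightarrow> 'a set" where
  "legal_moves G F S =
    {x \<in> verts G. \<exists>C \<in> components (G \<restriction> (verts G - closed_nbhd G S)).
       \<not> forbidden F C \<and> (\<exists>y \<in> verts C. x = y \<or> x \<rightarrow>\<^bsub>G\<^esub> y)}"

lemma legal_moves_subset: "legal_moves G F S \<subseteq> verts G - S"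
proof
  fix x assume "x \<in> legal_moves G F S"
  then obtain C y where x: "x \<in> verts G"
    and C: "C \<in> components (G \<restriction> (verts G - closed_nbhd G S))"
    and y: "y \<in> verts C" "x = y \<or> x \<rightarrow>\<^bsub>G\<^esub> y"
    unfolding legal_moves_def by blast
  from C have "verts C \<subseteq> verts G - closed_nbhd G S"
    unfolding components_def by (auto simp: pre_digraph.max_subgraph_def subgraph_def)
  with y have "x \<notin> S" by (auto simp: closed_nbhd_def)
  with x show "x \<in> verts G - S" by simp
qed

datatype player = Dominator | Staller

text \<open>
  The number of vertices still to be chosen under optimal play, when \<open>S\<close> is the set of vertices
  already chosen and the given player is to move. The finiteness guard only serves
  termination of the recursion on arbitrary \<open>G\<close>; it always holds for a \<^const>\<open>graph\<close>.
\<close>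

function remaining_moves ::
  "('a, 'b) pre_digraph \<Rightarrow> ('c, 'd) pre_digraph set \<Rightarrow> player \<Rightarrow> 'a set \<Rightarrow> nat" where
  "remaining_moves G F Dominator S =
    (if infinite (verts G) \<or> legal_moves G F S = {} then 0
     else 1 + Min ((\<lambda>x. remaining_moves G F Staller (insert x S)) ` legal_moves G F S))"
| "remaining_moves G F Staller S =
    (if infinite (verts G) \<or> legal_moves G F S = {} then 0
     else 1 + Max ((\<lambda>x. remaining_moves G F Dominator (insert x S)) ` legal_moves G F S))"
  by pat_completeness auto

termination
proof (relation "measure (\<lambda>(G, F, p, S). card (verts G - S))", goal_cases)
  case 1
  show ?case by simp
next
  case (2 G F S x)
  with legal_moves_subset[of G F S] show ?case
    by (auto intro!: psubset_card_mono)
next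
  case (3 G F S x)
  with legal_moves_subset[of G F S] show ?case
    by (auto intro!: psubset_card_mono)
qed

declare remaining_moves.simps [simp del]

definition isolation_game_number ::
  "('a, 'b) pre_digraph \<Rightarrow> ('c, 'd) pre_digraph set \<Rightarrow> nat" (\<open>\<iota>\<^sub>g\<close>) where
  "\<iota>\<^sub>g G F = remaining_moves G F Dominator {}"

definition staller_isolation_game_number ::
  "('a, 'b) pre_digraph \<Rightarrow> ('c, 'd) pre_digraph set \<Rightarrow> nat" (\<open>\<iota>\<^sub>g''\<close>) where
  "\<iota>\<^sub>g' G F = remaining_moves G F Staller {}"

end

theory Submission
  imports Defs
begin

text \<open>
  A position matters only through its set of active vertices, those lying in a component that is
  not yet forbidden: a move is legal iff it dominates an active vertex. If the active
  vertices of \<open>A\<close> are among those of \<open>B\<close>, this remains so when the same vertex is added to both.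
  Imagining the same moves in both positions gives a continuation principle: fewer active
  vertices never prolong the game. Hence the opponent's additional first move changes the
  length by at most one.
\<close>

section \<open>Maximal subgraphs of finite digraphs\<close>

text \<open>By finiteness, some candidate above \<open>K\<close> has the greatest number of vertices
  plus arcs, and nothing larger can satisfy \<open>P\<close>. Taken with \<open>connected\<close>,
  this places a connected subgraph inside a component.\<close>

lemma (in fin_digraph) ex_max_subgraph_above:
  assumes "subgraph K G" and "P K"
  obtains C where "max_subgraph P C" and "subgraph K C"
proof -
  let ?Q = "\<lambda>H. subgraph H G \<and> P H \<and> subgraph K H"
  let ?m = "\<lambda>H :: ('a, 'b) pre_digraph. card (verts H) + card (arcs H)"
  have "subgraph K K"
    using assms(1) by (auto intro: wf_digraph.subgraph_refl)
  then have "?Q K" using assms by simp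
  moreover have "\<forall>H. ?Q H \<longrightarrow> ?m H < Suc (card (verts G) + card (arcs G))"
    by (auto simp: subgraph_def less_Suc_eq_le intro!: add_mono card_mono)
  ultimately obtain C where C: "?Q C" and max: "\<And>H. ?Q H \<Longrightarrow> ?m H \<le> ?m C"
    using ex_has_greatest_nat[of ?Q K ?m] by blast
  have "max_subgraph P C"
  proof (rule max_subgraphI)
    show "P C" "subgraph C G" using C by auto
    fix H assume neq: "C \<noteq> H" and CH: "subgraph C H" and HG: "subgraph H G"
    show "\<not> P H"
    proof
      assume "P H"
      then have le: "?m H \<le> ?m C"
        using C CH HG by (intro max) (auto intro: subgraph_trans)
      have sub: "verts C \<subseteq> verts H" "arcs C \<subseteq> arcs H"
        using CH by (auto simp: subgraph_def)
      have fin: "finite (verts H)" "finite (arcs H)"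
        using HG by (auto simp: subgraph_def intro: finite_subset)
      have "card (verts C) \<le> card (verts H)" "card (arcs C) \<le> card (arcs H)"
        using sub fin by (auto intro: card_mono)
      with le have "card (verts C) = card (verts H)" "card (arcs C) = card (arcs H)"
        by linarith+
      with sub fin have "verts C = verts H" "arcs C = arcs H"
        by (simp_all add: card_subset_eq)
      \<comment> \<open>Equal vertex and arc sets do not yet give equal records; the incidence maps
        agree by compatibility.\<close>
      moreover have "tail C = tail H" "head C = head H"
        using CH by (auto simp: subgraph_def compatible_def)
      ultimately show False using neq by simp
    qed
  qed
  with C show thesis using that by blast
qed

lemma forbidden_subgraph:
  assumes "subgraph K G" and "forbidden F G"
  shows "forbidden F K"
  using assms unfolding forbidden_def contains_subgraph_def by (blast intro: subgraph_trans)

section \<open>Active vertices of a position\<close>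

definition active_verts ::
  "('a, 'b) pre_digraph \<Rightarrow> ('c, 'd) pre_digraph set \<Rightarrow> 'a set \<Rightarrow> 'a set" where
  "active_verts G F S =
    \<Union> (verts ` {C \<in> components (G \<restriction> (verts G - closed_nbhd G S)). \<not> forbidden F C})"

lemma legal_moves_active_verts:
  "legal_moves G F S = {x \<in> verts G. \<exists>y \<in> active_verts G F S. x = y \<or> x \<rightarrow>\<^bsub>G\<^esub> y}"
  unfolding legal_moves_def active_verts_def by blast

lemma legal_moves_mono:
  "active_verts G F A \<subseteq> active_verts G F B \<Longrightarrow> legal_moves G F A \<subseteq> legal_moves G F B"
  unfolding legal_moves_active_verts by blast

lemma active_verts_subset: "active_verts G F S \<subseteq> verts G - closed_nbhd G S"
  unfolding active_verts_def components_def
  by (auto simp: pre_digraph.max_subgraph_def subgraph_def)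

lemma closed_nbhd_insert: "closed_nbhd G (insert x S) = closed_nbhd G {x} \<union> closed_nbhd G S"
  unfolding closed_nbhd_def by blast

context fin_digraph
begin

text \<open>Turns subgraphs of the residual graph into subgraphs of \<open>G\<close> itself, so that
  positions with different chosen sets can share a witness.\<close>

lemma subgraph_induce_iff:
  assumes "V \<subseteq> verts G"
  shows "subgraph K (G \<restriction> V) \<longleftrightarrow> subgraph K G \<and> verts K \<subseteq> V"
proof
  assume "subgraph K (G \<restriction> V)"
  then show "subgraph K G \<and> verts K \<subseteq> V"
    using subgraph_trans[OF _ subgraph_induce_subgraphI[OF assms]]
    by (auto simp: subgraph_def)
next
  assume "subgraph K G \<and> verts K \<subseteq> V"
  then show "subgraph K (G \<restriction> V)"
    by (auto simp: subgraph_def compatible_def wf_digraph.wellformed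
        wellformed_induce_subgraph)
qed

text \<open>Maximality of components is irrelevant: forbiddenness passes to subgraphs.\<close>

lemma active_verts_iff:
  "v \<in> active_verts G F S \<longleftrightarrow>
    (\<exists>K. subgraph K G \<and> verts K \<inter> closed_nbhd G S = {} \<and> connected K \<and> \<not> forbidden F K
      \<and> v \<in> verts K)"
proof -
  let ?V = "verts G - closed_nbhd G S"
  have sub: "subgraph K (G \<restriction> ?V) \<longleftrightarrow> subgraph K G \<and> verts K \<inter> closed_nbhd G S = {}" for K
    using subgraph_induce_iff[of ?V K] by (auto simp: subgraph_def)
  interpret R: fin_digraph "G \<restriction> ?V"
    by (rule fin_digraph_subgraph) (auto intro: subgraph_induce_subgraphI)
  have "v \<in> active_verts G F S \<longleftrightarrow>
      (\<exists>K. subgraph K (G \<restriction> ?V) \<and> connected K \<and> \<not> forbidden F K \<and> v \<in> verts K)"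
  proof
    assume "v \<in> active_verts G F S"
    then show "\<exists>K. subgraph K (G \<restriction> ?V) \<and> connected K \<and> \<not> forbidden F K \<and> v \<in> verts K"
      unfolding active_verts_def components_def R.max_subgraph_def by blast
  next
    assume "\<exists>K. subgraph K (G \<restriction> ?V) \<and> connected K \<and> \<not> forbidden F K \<and> v \<in> verts K"
    then obtain K where K: "subgraph K (G \<restriction> ?V)" "connected K" "\<not> forbidden F K" "v \<in> verts K"
      by blast
    from R.ex_max_subgraph_above[of K connected, OF K(1,2)]
    obtain C where C: "R.max_subgraph connected C" "subgraph K C" .
    have "\<not> forbidden F C" using forbidden_subgraph[OF C(2)] K(3) by blast
    moreover have "v \<in> verts C" using C(2) K(4) by (auto simp: subgraph_def)
    ultimately show "v \<in> active_verts G F S"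
      using C(1) unfolding active_verts_def components_def by blast
  qed
  then show ?thesis unfolding sub by blast
qed

lemma subset_active_verts:
  assumes "subgraph K G" and "verts K \<inter> closed_nbhd G S = {}"
    and "connected K" and "\<not> forbidden F K"
  shows "verts K \<subseteq> active_verts G F S"
proof
  fix v assume "v \<in> verts K"
  with assms show "v \<in> active_verts G F S"
    unfolding active_verts_iff by blast
qed

text \<open>A witness \<open>K\<close> for \<open>insert x A\<close> avoids the neighborhood of
  \<open>A\<close>, so all its vertices are active for \<open>A\<close>, hence for \<open>B\<close>,
  and \<open>K\<close> avoids the neighborhood of \<open>B\<close> too. The same \<open>K\<close> is
  then a witness for \<open>insert x B\<close>.\<close>

lemma active_verts_insert_mono:
  assumes "active_verts G F A \<subseteq> active_verts G F B"
  shows "active_verts G F (insert x A) \<subseteq> active_verts G F (insert x B)"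
proof
  fix v assume "v \<in> active_verts G F (insert x A)"
  then obtain K where K: "subgraph K G" "verts K \<inter> closed_nbhd G (insert x A) = {}"
    "connected K" "\<not> forbidden F K" "v \<in> verts K"
    unfolding active_verts_iff by blast
  have "verts K \<inter> closed_nbhd G A = {}"
    using K(2) unfolding closed_nbhd_insert[of G x A] by blast
  with K have "verts K \<subseteq> active_verts G F A"
    by (intro subset_active_verts)
  also have "\<dots> \<subseteq> verts G - closed_nbhd G B"
    using assms active_verts_subset by (rule order_trans)
  finally have "verts K \<inter> closed_nbhd G (insert x B) = {}"
    using K(2) unfolding closed_nbhd_insert[of G x A] closed_nbhd_insert[of G x B] by blast
  with K show "v \<in> active_verts G F (insert x B)"
    unfolding active_verts_iff by blast
qed

lemma active_verts_insert_subset: "active_verts G F (insert x S) \<subseteq> active_verts G F S"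
proof
  fix v assume "v \<in> active_verts G F (insert x S)"
  then show "v \<in> active_verts G F S"
    unfolding active_verts_iff closed_nbhd_insert[of G x S] by blast
qed

text \<open>All vertices of a witness are active, and an illegal \<open>x\<close> dominates none of
  them, so the witness survives the choice of \<open>x\<close>.\<close>

lemma active_verts_insert_illegal:
  assumes "x \<in> verts G" and "x \<notin> legal_moves G F S"
  shows "active_verts G F S \<subseteq> active_verts G F (insert x S)"
proof
  fix v assume "v \<in> active_verts G F S"
  then obtain K where K: "subgraph K G" "verts K \<inter> closed_nbhd G S = {}"
    "connected K" "\<not> forbidden F K" "v \<in> verts K"
    unfolding active_verts_iff by blast
  then have "verts K \<subseteq> active_verts G F S"
    by (intro subset_active_verts)
  then have "verts K \<inter> closed_nbhd G {x} = {}"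
    using assms unfolding legal_moves_active_verts closed_nbhd_def by blast
  with K show "v \<in> active_verts G F (insert x S)"
    unfolding active_verts_iff closed_nbhd_insert[of G x S] by blast
qed

section \<open>Optimal play and the continuation principle\<close>

lemma finite_legal_moves: "finite (legal_moves G F S)"
  using legal_moves_subset[of G F S] finite_verts by (meson Diff_subset finite_subset)

lemma remaining_moves_Dominator_le:
  assumes "x \<in> legal_moves G F S"
  shows "remaining_moves G F Dominator S \<le> Suc (remaining_moves G F Staller (insert x S))"
  using assms finite_legal_moves by (auto simp: remaining_moves.simps(1)[of G F S] intro: Min_le)

lemma remaining_moves_Staller_ge:
  assumes "x \<in> legal_moves G F S"
  shows "Suc (remaining_moves G F Dominator (insert x S)) \<le> remaining_moves G F Staller S"
  using assms finite_legal_moves by (auto simp: remaining_moves.simps(2)[of G F S] intro: Max_ge)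

lemma remaining_moves_no_legal_moves:
  "legal_moves G F S = {} \<Longrightarrow> remaining_moves G F p S = 0"
  by (cases p) (simp_all add: remaining_moves.simps)

lemma optimal_Dominator_move:
  assumes "legal_moves G F S \<noteq> {}"
  obtains x where "x \<in> legal_moves G F S"
    and "remaining_moves G F Dominator S = Suc (remaining_moves G F Staller (insert x S))"
proof -
  let ?R = "(\<lambda>x. remaining_moves G F Staller (insert x S)) ` legal_moves G F S"
  have "Min ?R \<in> ?R" using assms finite_legal_moves by (intro Min_in) auto
  then obtain x where "x \<in> legal_moves G F S"
    and "Min ?R = remaining_moves G F Staller (insert x S)" by blast
  with assms show thesis
    using that by (simp add: remaining_moves.simps(1)[of G F S])
qed

lemma optimal_Staller_move:
  assumes "legal_moves G F S \<noteq> {}"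
  obtains x where "x \<in> legal_moves G F S"
    and "remaining_moves G F Staller S = Suc (remaining_moves G F Dominator (insert x S))"
proof -
  let ?R = "(\<lambda>x. remaining_moves G F Dominator (insert x S)) ` legal_moves G F S"
  have "Max ?R \<in> ?R" using assms finite_legal_moves by (intro Max_in) auto
  then obtain x where "x \<in> legal_moves G F S"
    and "Max ?R = remaining_moves G F Dominator (insert x S)" by blast
  with assms show thesis
    using that by (simp add: remaining_moves.simps(2)[of G F S])
qed

text \<open>Induction on the vertices not yet chosen in \<open>B\<close>, for both players at once:
  each player to move imitates an optimal move from the other position.\<close>

lemma continuation_principle:
  assumes "active_verts G F A \<subseteq> active_verts G F B"
  shows "remaining_moves G F p A \<le> remaining_moves G F p B"
  using assms
proof (induction "card (verts G - B)" arbitrary: A B p rule: less_induct)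
  case less
  \<comment> \<open>Only \<open>B\<close> has to grow by \<open>x\<close>; \<open>A'\<close> stays
    free, since the move made in \<open>A\<close> may be a different one.\<close>
  have IH: "remaining_moves G F q A' \<le> remaining_moves G F q (insert x B)"
    if "x \<in> legal_moves G F B" "active_verts G F A' \<subseteq> active_verts G F (insert x B)" for x A' q
  proof (rule less.hyps)
    show "card (verts G - insert x B) < card (verts G - B)"
      using that(1) legal_moves_subset[of G F B] by (intro psubset_card_mono) auto
  qed fact
  have legal: "legal_moves G F A \<subseteq> legal_moves G F B"
    using less.prems by (rule legal_moves_mono)
  show ?case
  proof (cases "legal_moves G F A = {}")
    case True
    then show ?thesis by (simp add: remaining_moves_no_legal_moves)
  next
    case nonempty: False
    show ?thesis
    proof (cases p)
      case Staller
      \<comment> \<open>Staller maximizes, so her best move in \<open>A\<close> is copied to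
        \<open>B\<close>, where it is always legal.\<close>
      obtain x where x: "x \<in> legal_moves G F A"
        "remaining_moves G F Staller A = Suc (remaining_moves G F Dominator (insert x A))"
        using optimal_Staller_move[OF nonempty] .
      have xB: "x \<in> legal_moves G F B" using x(1) legal by blast
      have "remaining_moves G F Dominator (insert x A) \<le> remaining_moves G F Dominator (insert x B)"
        by (rule IH[OF xB active_verts_insert_mono[OF less.prems]])
      then show ?thesis
        using x(2) remaining_moves_Staller_ge[OF xB] Staller by simp
    next
      case Dominator
      have "legal_moves G F B \<noteq> {}" using nonempty legal by blast
      \<comment> \<open>Dominator minimizes, so the imitation runs from \<open>B\<close> to
        \<open>A\<close>, where \<open>x\<close> may be illegal; \<open>y\<close> below is a legal
        move that leaves no more active vertices than \<open>x\<close> would.\<close>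
      then obtain x where x: "x \<in> legal_moves G F B"
        "remaining_moves G F Dominator B = Suc (remaining_moves G F Staller (insert x B))"
        by (rule optimal_Dominator_move)
      obtain y where y: "y \<in> legal_moves G F A"
        "active_verts G F (insert y A) \<subseteq> active_verts G F (insert x A)"
      proof (cases "x \<in> legal_moves G F A")
        case True
        then show ?thesis using that by blast
      next
        \<comment> \<open>An illegal \<open>x\<close> leaves the active vertices of \<open>A\<close> unchanged, so any legal move serves.\<close>
        case False
        obtain y where "y \<in> legal_moves G F A" using nonempty by blast
        moreover have "x \<in> verts G" using x(1) by (simp add: legal_moves_def)
        ultimately show ?thesis
          using that active_verts_insert_subset active_verts_insert_illegal[OF _ False] by blast
      qed
      have "active_verts G F (insert y A) \<subseteq> active_verts G F (insert x B)"
        using y(2) active_verts_insert_mono[OF less.prems] by blast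
      then have "remaining_moves G F Staller (insert y A) \<le> remaining_moves G F Staller (insert x B)"
        by (rule IH[OF x(1)])
      then show ?thesis
        using x(2) remaining_moves_Dominator_le[OF y(1)] Dominator by simp
    qed
  qed
qed

section \<open>Comparison of the two starting players\<close>

lemma remaining_moves_insert_le:
  "remaining_moves G F p (insert x S) \<le> remaining_moves G F p S"
  by (rule continuation_principle[OF active_verts_insert_subset])

text \<open>Dominator can open with any legal move: Staller then moves in a position that lasts no
  longer than \<open>S\<close> would with her to move.\<close>

lemma remaining_moves_Dominator_le_Staller:
  "remaining_moves G F Dominator S \<le> Suc (remaining_moves G F Staller S)"
proof (cases "legal_moves G F S = {}")
  case False
  then obtain x where "x \<in> legal_moves G F S" by blast
  then show ?thesis
    using remaining_moves_Dominator_le remaining_moves_insert_le[of F Staller x S]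
    by (meson Suc_le_mono order_trans)
qed (simp add: remaining_moves_no_legal_moves)

text \<open>Even the best opening of Staller adds just one move, because it cannot prolong the game
  that Dominator then starts.\<close>

lemma remaining_moves_Staller_le_Dominator:
  "remaining_moves G F Staller S \<le> Suc (remaining_moves G F Dominator S)"
proof (cases "legal_moves G F S = {}")
  case False
  then show ?thesis
    using optimal_Staller_move remaining_moves_insert_le[of F Dominator _ S]
    by (metis Suc_le_mono)
qed (simp add: remaining_moves_no_legal_moves)

end

theorem theorem2p3:
  fixes G :: "('a, 'b) pre_digraph" and F :: "('c, 'd) pre_digraph set"
  assumes "graph G" and "\<And>H. H \<in> F \<Longrightarrow> graph H"
  shows "\<bar>int (\<iota>\<^sub>g G F) - int (\<iota>\<^sub>g' G F)\<bar> \<le> 1"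
proof -
  interpret graph G by fact
  show ?thesis
    using remaining_moves_Dominator_le_Staller[of F "{}"]
      remaining_moves_Staller_le_Dominator[of F "{}"]
    unfolding isolation_game_number_def staller_isolation_game_number_def by linarith
qed

end
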